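(* The Laplace transform of the vector $(e^{B_t},\int_0^te^{2B_u}\,du)$ is given by $$\mathbb{E}\exp\Bigl(-\gamma e^{B_t}-\frac{\lambda^2}{2}\int_0^te^{2B_u}\,du\Bigr)=\mathbb{E}\exp\bigl(-\lambda\cosh(x+B_t)\bigr)$$ for $\gamma>0$ and $\lambda>0$, where $x=\operatorname{arcosh}\frac{\gamma}{\lambda}$.
   Context: $B$ is a standard Brownian motion and $t$ is a fixed (deterministic) time. $\operatorname{arcosh}$ denotes the inverse function of $\cosh$, $\operatorname{arcosh}(y)=\ln\bigl(y+\sqrt{y^2-1}\bigr)$. *)

theory Defs
  imports "HOL-Probability.Probability"
begin

(* Paths are continuous for every outcome, not merely almost every one: M is not assumed
   complete, so with almost sure continuity path functionals such as the integral of
   exp (2 * B u) over u might fail to be measurable. *)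
locale standard_brownian_motion = prob_space M
  for M :: "'a measure" and B :: "real \<Rightarrow> 'a \<Rightarrow> real" +
  assumes measurable_at: "0 \<le> t \<Longrightarrow> B t \<in> borel_measurable M"
    and start_zero: "AE \<omega> in M. B 0 \<omega> = 0"
    and independent_increments:
      "\<lbrakk>0 \<le> \<tau> 0; \<And>i. i < n \<Longrightarrow> \<tau> i < \<tau> (Suc i)\<rbrakk> \<Longrightarrow>
        indep_vars (\<lambda>_. borel) (\<lambda>i \<omega>. B (\<tau> (Suc i)) \<omega> - B (\<tau> i) \<omega>) {..<(n::nat)}"
    and normal_increments:
      "\<lbrakk>0 \<le> s; s < t\<rbrakk> \<Longrightarrow>
        distributed M lborel (\<lambda>\<omega>. B t \<omega> - B s \<omega>) (normal_density 0 (sqrt (t - s)))"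
    and continuous_paths: "\<omega> \<in> space M \<Longrightarrow> continuous_on {0..} (\<lambda>t. B t \<omega>)"

end

theory Submission imports Defs begin

text \<open>The idea is that the kernel \<open>f(b,y) = exp (- \<lambda> e\<^sup>b cosh y)\<close> turns one diffusion into another: it
satisfies \<open>(1/2) f\<^sub>b\<^sub>b - (1/2) \<lambda>\<^sup>2 e\<^sup>2\<^sup>b f = (1/2) f\<^sub>y\<^sub>y\<close>, because \<open>cosh\<^sup>2 y - sinh\<^sup>2 y = 1\<close>. Hence a
Brownian motion in the scale variable \<open>b\<close>, killed at rate \<open>(1/2) \<lambda>\<^sup>2 e\<^sup>2\<^sup>b\<close>, acts on \<open>f\<close> in the
same way as a free Brownian motion in the angle variable \<open>y\<close>. Started from \<open>b = 0\<close> and \<open>y = x\<close>,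
the first motion produces, by the Feynman-Kac formula, the expectation of
\<open>exp (- \<lambda> cosh x e\<^sup>B\<^sup>t - (\<lambda>\<^sup>2/2) \<integral> e\<^sup>2\<^sup>B\<^sup>u du)\<close>, and the second one that of
\<open>exp (- \<lambda> cosh (x + B\<^sub>t))\<close>. Since \<open>\<lambda> cosh x = \<gamma>\<close>, these are the two sides of the claim.

The argument is carried out in discrete time, without stochastic calculus. A Gaussian step of
variance \<open>\<sigma>\<^sup>2\<close> in \<open>b\<close>, discounted, differs from such a step in \<open>y\<close> by
\<open>O(\<sigma>\<^sup>3)\<close> for small \<open>\<sigma>\<close>, uniformly in \<open>b\<close> and in the real part of \<open>y\<close> (\<open>gaussian_step_exchange\<close>). For the
walk obtained by sampling the Brownian path at \<open>n\<close> equidistant times, the steps are exchanged one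
at a time (\<open>walk_exchange_error\<close>). With \<open>\<sigma>\<^sup>2 = t / n\<close> the total error is of order
\<open>n \<sigma>\<^sup>3\<close>, hence vanishes in the limit, and the discounts become the integral by convergence of
Riemann sums along the continuous paths.

Complex angles cause no trouble as long as \<^term>\<open>0 < cos (Im x)\<close>: then \<^term>\<open>cosh (x + of_real s)\<close>
stays in a fixed sector of the right half plane for all real \<open>s\<close>, and the kernel decays. This covers
\<open>\<gamma> < \<lambda>\<close>, where \<open>x\<close> is imaginary, together with \<open>\<gamma> \<ge> \<lambda>\<close>.\<close>

section \<open>Small Gaussian increments\<close>

abbreviation centred_gaussian :: "real \<Rightarrow> real measure" where
  "centred_gaussian \<sigma> \<equiv> density lborel (\<lambda>x. ennreal (normal_density 0 \<sigma> x))"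

lemma has_bochner_integral_gaussianI:
  fixes g :: "real \<Rightarrow> real"
  assumes "has_bochner_integral lborel (\<lambda>x. normal_density 0 \<sigma> x * g x) c"
    and "g \<in> borel_measurable borel"
  shows "has_bochner_integral (centred_gaussian \<sigma>) g c"
  using assms by (intro has_bochner_integral_density) simp_all

lemma gaussian_moments:
  assumes "0 < \<sigma>"
  shows "has_bochner_integral (centred_gaussian \<sigma>) (\<lambda>w. w) 0"
    and "has_bochner_integral (centred_gaussian \<sigma>) (\<lambda>w. w\<^sup>2) (\<sigma>\<^sup>2)"
    and "has_bochner_integral (centred_gaussian \<sigma>) (\<lambda>w. \<bar>w\<bar> ^ 3) (2 * \<sigma> ^ 3 * sqrt (2 / pi))"
  using normal_moment_odd[OF assms, of 0 0] normal_moment_even[OF assms, of 0 1]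
    normal_moment_abs_odd[OF assms, of 0 1]
  by (auto intro!: has_bochner_integral_gaussianI simp: numeral_3_eq_3 power2_eq_square)

text \<open>Averaging a second-order expansion against a centred Gaussian kills the linear term and turns
the quadratic one into the variance; the cubic remainder costs only the third absolute moment.\<close>

lemma gaussian_integral_Taylor:
  fixes g :: "real \<Rightarrow> complex"
  assumes "0 < \<sigma>" and [measurable]: "g \<in> borel_measurable borel"
    and Taylor: "\<And>w. cmod (g w - (a + b * of_real w + c / 2 * of_real (w\<^sup>2))) \<le> K * \<bar>w\<bar> ^ 3"
    and "0 \<le> K"
  shows "cmod ((\<integral>w. g w \<partial>centred_gaussian \<sigma>) - (a + c / 2 * of_real (\<sigma>\<^sup>2))) \<le> 2 * K * \<sigma> ^ 3"
proof -
  let ?N = "centred_gaussian \<sigma>"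
  let ?p = "\<lambda>w. a + b * of_real w + c / 2 * of_real (w\<^sup>2)"
  interpret N: prob_space ?N
    using \<open>0 < \<sigma>\<close> by (rule prob_space_normal_density)
  have "has_bochner_integral ?N (\<lambda>w. a) a"
    using N.prob_space by (auto simp: has_bochner_integral_iff)
  moreover note has_bochner_integral_mult_right[OF has_bochner_integral_of_real[OF gaussian_moments(1)[OF \<open>0 < \<sigma>\<close>]], of b]
  moreover note has_bochner_integral_mult_right[OF has_bochner_integral_of_real[OF gaussian_moments(2)[OF \<open>0 < \<sigma>\<close>]], of "c / 2"]
  ultimately have p: "has_bochner_integral ?N ?p (a + c / 2 * of_real (\<sigma>\<^sup>2))"
    using has_bochner_integral_add[OF has_bochner_integral_add] by fastforce
  have r: "integrable ?N (\<lambda>w. K * \<bar>w\<bar> ^ 3)"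
    using gaussian_moments(3)[OF \<open>0 < \<sigma>\<close>] by (auto simp: has_bochner_integral_iff)
  have diff: "integrable ?N (\<lambda>w. g w - ?p w)"
    by (rule Bochner_Integration.integrable_bound[OF r]) (use Taylor \<open>0 \<le> K\<close> in auto)
  have g: "integrable ?N g"
    using Bochner_Integration.integrable_add[OF diff integrable.intros[OF p]] by simp
  have "(\<integral>w. g w \<partial>?N) - (a + c / 2 * of_real (\<sigma>\<^sup>2)) = (\<integral>w. g w - ?p w \<partial>?N)"
    using g p by (subst Bochner_Integration.integral_diff) (auto simp: has_bochner_integral_iff)
  also have "cmod \<dots> \<le> (\<integral>w. K * \<bar>w\<bar> ^ 3 \<partial>?N)"
    by (intro Bochner_Integration.integral_norm_bound_integral diff r Taylor)
  also have "\<dots> = K * (2 * \<sigma> ^ 3 * sqrt (2 / pi))"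
    using gaussian_moments(3)[OF \<open>0 < \<sigma>\<close>] by (simp add: has_bochner_integral_iff)
  also have "\<dots> \<le> K * (2 * \<sigma> ^ 3 * 1)"
    using \<open>0 \<le> K\<close> \<open>0 < \<sigma>\<close> pi_gt3 by (intro mult_left_mono) auto
  finally show ?thesis by simp
qed

text \<open>The source of all bounds that are uniform in the starting point: polynomial factors produced by
differentiation are absorbed by the exponential decay of the kernel.\<close>

lemma power_exp_neg_le_fact:
  fixes R :: real
  assumes "0 \<le> R"
  shows "R ^ k * exp (- R) \<le> fact k"
proof -
  have "(\<Sum>n\<in>{k}. R ^ n /\<^sub>R fact n) \<le> (\<Sum>n. R ^ n /\<^sub>R fact n)"
    by (rule sum_le_suminf) (use assms summable_exp_generic[of R] in \<open>auto intro!: scaleR_nonneg_nonneg simp del: scaleR_conv_of_real real_scaleR_def\<close>)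
  then have "R ^ k / fact k \<le> exp R"
    by (simp add: exp_def field_simps)
  then show ?thesis
    by (simp add: exp_minus field_simps)
qed

lemma exp_neg_le_quadratic:
  fixes v :: real
  assumes "0 \<le> v"
  shows "exp (- v) \<le> 1 - v + v\<^sup>2 / 2"
proof -
  have "1 \<le> (1 - v + v\<^sup>2 / 2) * (1 + v + v\<^sup>2 / 2)"
    by (simp add: algebra_simps power2_eq_square mult_nonneg_nonneg assms)
  also have "\<dots> \<le> (1 - v + v\<^sup>2 / 2) * exp v"
  proof (rule mult_left_mono)
    show "0 \<le> 1 - v + v\<^sup>2 / 2"
      using zero_le_power2[of "1 - v"] by (simp add: power2_diff)
  qed (use assms exp_lower_Taylor_quadratic in auto)
  finally show ?thesis
    by (simp add: exp_minus field_simps)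
qed

text \<open>One expansion serves both motions of interest. The kernel \<^term>\<open>exp (- r * cosh y)\<close>
with \<open>r\<close> replaced by \<open>r e\<^sup>w\<close> has \<open>\<beta> = 0\<close>, and with \<open>y\<close> replaced by \<open>y + w\<close> it has
\<open>\<alpha> = r e\<^sup>y / 2\<close> and \<open>\<beta> = r e\<^sup>-\<^sup>y / 2\<close>. The hypotheses confine \<open>\<alpha>\<close> and \<open>\<beta>\<close> to a sector around
the positive axis, so that \<open>p = \<alpha> e\<^sup>w + \<beta> e\<^sup>-\<^sup>w\<close> and its derivative are dominated by \<open>Re p\<close>, and
the third derivative of \<open>e\<^sup>-\<^sup>p\<close> is bounded by a constant depending on the sector alone.\<close>

lemma double_exponential_Taylor:
  fixes \<alpha> \<beta> :: complex
  assumes \<alpha>: "cmod \<alpha> \<le> C * Re \<alpha>" and \<beta>: "cmod \<beta> \<le> C * Re \<beta>" and "0 < C"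
  shows "cmod (exp (- (\<alpha> * exp (of_real w) + \<beta> * exp (- of_real w)))
      - (exp (- (\<alpha> + \<beta>)) - (\<alpha> - \<beta>) * exp (- (\<alpha> + \<beta>)) * of_real w
         + ((\<alpha> - \<beta>)\<^sup>2 - (\<alpha> + \<beta>)) * exp (- (\<alpha> + \<beta>)) / 2 * of_real (w\<^sup>2)))
    \<le> (3 * C ^ 3 + 3 * C\<^sup>2 + C) * \<bar>w\<bar> ^ 3"
proof -
  define p q g where "p = (\<lambda>z. \<alpha> * exp z + \<beta> * exp (- z))" and "q = (\<lambda>z. \<alpha> * exp z - \<beta> * exp (- z))"
    and "g = (\<lambda>z. exp (- p z))"
  have p': "(p has_field_derivative q z) (at z)" for z
    unfolding p_def q_def by (auto intro!: derivative_eq_intros)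
  have q': "(q has_field_derivative p z) (at z)" for z
    unfolding p_def q_def by (auto intro!: derivative_eq_intros)
  have g': "(g has_field_derivative - q z * g z) (at z)" for z
    unfolding g_def by (auto intro!: derivative_eq_intros p')
  \<comment> \<open>The successive derivatives of \<open>g\<close>, computed from \<open>p' = q\<close> and \<open>q' = p\<close>.\<close>
  define G where "G = (\<lambda>i::nat. case i of 0 \<Rightarrow> g | Suc 0 \<Rightarrow> (\<lambda>z. - q z * g z)
    | Suc (Suc 0) \<Rightarrow> (\<lambda>z. ((q z)\<^sup>2 - p z) * g z)
    | _ \<Rightarrow> (\<lambda>z. (3 * p z * q z - q z - q z ^ 3) * g z))"
  have deriv: "(G i has_field_derivative G (Suc i) z) (at z within \<real>)" if "i \<le> 2" for i z
  proof -
    have "i = 0 \<or> i = Suc 0 \<or> i = Suc (Suc 0)"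
      using that by arith
    then consider "i = 0" | "i = Suc 0" | "i = Suc (Suc 0)"
      by blast
    then show ?thesis
    proof cases
      case 1
      then show ?thesis using has_field_derivative_at_within[OF g'] by (simp add: G_def)
    next
      case 2
      have "((\<lambda>z. - q z * g z) has_field_derivative ((q z)\<^sup>2 - p z) * g z) (at z)"
        by (auto intro!: derivative_eq_intros g' q' simp: power2_eq_square algebra_simps)
      from has_field_derivative_at_within[OF this] 2 show ?thesis by (simp add: G_def)
    next
      case 3
      have "((\<lambda>z. ((q z)\<^sup>2 - p z) * g z) has_field_derivative (3 * p z * q z - q z - q z ^ 3) * g z) (at z)"
        by (rule derivative_eq_intros g' q' p' refl)+
          (simp add: power2_eq_square power3_eq_cube algebra_simps)
      from has_field_derivative_at_within[OF this] 3 show ?thesis by (simp add: G_def)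
    qed
  qed
  have bound: "cmod (G (Suc 2) z) \<le> 2 * (3 * C ^ 3 + 3 * C\<^sup>2 + C)" if "z \<in> \<real>" for z
  proof -
    obtain s where z: "z = of_real s"
      using \<open>z \<in> \<real>\<close> by (auto elim: Reals_cases)
    define R where "R = Re (p z)"
    have R: "R = Re \<alpha> * exp s + Re \<beta> * exp (- s)"
      by (simp add: R_def p_def z Re_exp Im_exp)
    have "0 \<le> R"
    proof -
      have "0 \<le> Re \<alpha>" "0 \<le> Re \<beta>"
        using \<alpha> \<beta> \<open>0 < C\<close> by (meson norm_ge_zero order_trans zero_le_mult_iff not_less)+
      then show ?thesis by (simp add: R)
    qed
    have abs: "cmod (\<alpha> * exp z) + cmod (\<beta> * exp (- z)) \<le> C * R"
    proof -
      have "cmod (\<alpha> * exp z) + cmod (\<beta> * exp (- z)) = cmod \<alpha> * exp s + cmod \<beta> * exp (- s)"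
        by (simp add: z norm_mult norm_exp_eq_Re)
      also have "\<dots> \<le> C * Re \<alpha> * exp s + C * Re \<beta> * exp (- s)"
        by (intro add_mono mult_right_mono \<alpha> \<beta>) auto
      finally show ?thesis by (simp add: R algebra_simps)
    qed
    have p: "cmod (p z) \<le> C * R"
      unfolding p_def using abs norm_triangle_ineq[of "\<alpha> * exp z" "\<beta> * exp (- z)"] by linarith
    have q: "cmod (q z) \<le> C * R"
      unfolding q_def using abs norm_triangle_ineq4[of "\<alpha> * exp z" "\<beta> * exp (- z)"] by linarith
    have "cmod (3 * p z * q z - q z - q z ^ 3) \<le> cmod (3 * p z * q z) + cmod (q z) + cmod (q z ^ 3)"
      using norm_triangle_ineq4[of "3 * p z * q z - q z" "q z ^ 3"]
        norm_triangle_ineq4[of "3 * p z * q z" "q z"] by linarith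
    also have "\<dots> \<le> 3 * (C * R) * (C * R) + C * R + (C * R) ^ 3"
      unfolding norm_mult norm_power using p q \<open>0 \<le> R\<close> \<open>0 < C\<close>
      by (intro add_mono mult_mono power_mono) auto
    finally have "cmod (G (Suc 2) z) \<le> (3 * (C * R) * (C * R) + C * R + (C * R) ^ 3) * exp (- R)"
      by (simp add: G_def numeral_2_eq_2 g_def norm_mult norm_exp_eq_Re R_def mult_right_mono)
    also have "\<dots> = 3 * C\<^sup>2 * (R ^ 2 * exp (- R)) + C * (R ^ 1 * exp (- R)) + C ^ 3 * (R ^ 3 * exp (- R))"
      by (simp add: algebra_simps power2_eq_square power3_eq_cube)
    also have "\<dots> \<le> 3 * C\<^sup>2 * fact 2 + C * fact 1 + C ^ 3 * fact 3"
      using \<open>0 < C\<close> \<open>0 \<le> R\<close> by (intro add_mono mult_left_mono power_exp_neg_le_fact) auto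
    also have "\<dots> \<le> 2 * (3 * C ^ 3 + 3 * C\<^sup>2 + C)"
      using \<open>0 < C\<close> by (simp add: fact_numeral)
    finally show ?thesis .
  qed
  have "cmod (G 0 (of_real w) - (\<Sum>i\<le>2. G i 0 * (of_real w - 0) ^ i / fact i))
      \<le> 2 * (3 * C ^ 3 + 3 * C\<^sup>2 + C) * cmod (of_real w - 0) ^ Suc 2 / fact 2"
    by (rule complex_Taylor[where S = "\<real>"]) (use convex_Reals deriv bound in auto)
  then show ?thesis
    by (simp add: G_def numeral_2_eq_2 g_def p_def q_def norm_power numeral_3_eq_3 algebra_simps)
qed

section \<open>Exchanging a motion of the scale for a motion of the angle\<close>

definition cosh_kernel :: "real \<Rightarrow> complex \<Rightarrow> complex" where
  "cosh_kernel r y = exp (- of_real r * cosh y)"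

lemma Re_cosh_complex: "Re (cosh y) = cosh (Re y) * cos (Im y)"
  by (simp add: cosh_def Re_exp field_simps)

text \<open>This is the heart of the matter. Write \<open>f(b,y) = exp (- \<lambda> e\<^sup>b cosh y)\<close> and \<open>r = \<lambda> e\<^sup>b\<close>. Then
\<open>f\<^sub>b\<^sub>b - f\<^sub>y\<^sub>y = r\<^sup>2 (cosh\<^sup>2 y - sinh\<^sup>2 y) f = r\<^sup>2 f\<close>, that is, \<open>(1/2) f\<^sub>b\<^sub>b - (r\<^sup>2/2) f = (1/2) f\<^sub>y\<^sub>y\<close>.
So a Gaussian step of variance \<open>\<sigma>\<^sup>2\<close> in \<open>b\<close>, discounted at rate \<open>r\<^sup>2/2\<close>, agrees with a Gaussian step
in \<open>y\<close> up to an error \<open>o(\<sigma>\<^sup>2)\<close>. The error is uniform in \<open>r\<close> and \<open>y\<close> as long as the imaginary part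
of \<open>y\<close> is kept fixed.\<close>

lemma gaussian_step_exchange:
  assumes "0 < c"
  obtains K where "\<And>r y \<sigma>. \<lbrakk>0 < r; cos (Im y) = c; 0 < \<sigma>\<rbrakk> \<Longrightarrow>
      cmod (of_real (exp (- (\<sigma>\<^sup>2 / 2 * r\<^sup>2))) * (\<integral>w. cosh_kernel (r * exp w) y \<partial>centred_gaussian \<sigma>)
        - (\<integral>w. cosh_kernel r (y + of_real w) \<partial>centred_gaussian \<sigma>)) \<le> K * (\<sigma> ^ 3 + \<sigma> ^ 4)"
proof -
  \<comment> \<open>The opening of the sector: \<open>\<bar>e\<^sup>z\<bar> = Re (e\<^sup>z) / cos (Im z)\<close>.\<close>
  define C K\<^sub>1 where "C = 1 / c" and "K\<^sub>1 = 3 * C ^ 3 + 3 * C\<^sup>2 + C"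
  have "0 < C" "0 < K\<^sub>1"
    using \<open>0 < c\<close> by (auto simp: C_def K\<^sub>1_def intro!: add_pos_pos)
  define K where "K = 4 * K\<^sub>1 + 9 * C ^ 4 + 2 * C ^ 3"
  have "cmod (of_real (exp (- (\<sigma>\<^sup>2 / 2 * r\<^sup>2))) * (\<integral>w. cosh_kernel (r * exp w) y \<partial>centred_gaussian \<sigma>)
        - (\<integral>w. cosh_kernel r (y + of_real w) \<partial>centred_gaussian \<sigma>)) \<le> K * (\<sigma> ^ 3 + \<sigma> ^ 4)"
    if "0 < r" "cos (Im y) = c" "0 < \<sigma>" for r y \<sigma>
  proof -
    let ?N = "centred_gaussian \<sigma>"
    define a b where "a = of_real r * cosh y" and "b = of_real r * sinh y"
    define R where "R = Re a"
    define e where "e = exp (- (\<sigma>\<^sup>2 / 2 * r\<^sup>2))"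
    define I J where "I = (\<integral>w. cosh_kernel (r * exp w) y \<partial>?N)"
      and "J = (\<integral>w. cosh_kernel r (y + of_real w) \<partial>?N)"
    \<comment> \<open>The second-order expansions of the two averages.\<close>
    define P Q where "P = exp (- a) + (a\<^sup>2 - a) * exp (- a) / 2 * of_real (\<sigma>\<^sup>2)"
      and "Q = exp (- a) + (b\<^sup>2 - a) * exp (- a) / 2 * of_real (\<sigma>\<^sup>2)"
    have R: "R = r * cosh (Re y) * c"
      by (simp add: R_def a_def Re_cosh_complex \<open>cos (Im y) = c\<close>)
    have "r \<le> C * R"
      using \<open>0 < r\<close> \<open>0 < c\<close> cosh_real_ge_1[of "Re y"] by (simp add: R C_def)
    have "0 \<le> R"
      using \<open>0 < r\<close> \<open>0 < c\<close> by (simp add: R)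
    have half: "cmod (of_real r * exp z / 2) \<le> C * Re (of_real r * exp z / 2)" if "cos (Im z) = c" for z
      using \<open>0 < r\<close> \<open>0 < c\<close> that by (simp add: norm_mult norm_divide norm_exp_eq_Re Re_exp C_def)
    have a_le: "cmod a \<le> C * R"
    proof -
      have "cmod a \<le> cmod (of_real r * exp y / 2) + cmod (of_real r * exp (- y) / 2)"
        using norm_triangle_ineq[of "of_real r * exp y / 2" "of_real r * exp (- y) / 2"]
        by (simp add: a_def cosh_field_def field_simps)
      also have "\<dots> \<le> C * Re (of_real r * exp y / 2) + C * Re (of_real r * exp (- y) / 2)"
        using \<open>cos (Im y) = c\<close> by (intro add_mono half) auto
      also have "\<dots> = C * R"
        by (simp add: R_def a_def cosh_field_def field_simps)
      finally show ?thesis .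
    qed
    have I: "cmod (I - P) \<le> 2 * K\<^sub>1 * \<sigma> ^ 3"
      unfolding I_def P_def
    proof (rule gaussian_integral_Taylor[OF \<open>0 < \<sigma>\<close>])
      show "(\<lambda>w. cosh_kernel (r * exp w) y) \<in> borel_measurable borel"
        unfolding cosh_kernel_def by measurable
      show "cmod (cosh_kernel (r * exp w) y - (exp (- a) + - a * exp (- a) * of_real w
          + (a\<^sup>2 - a) * exp (- a) / 2 * of_real (w\<^sup>2))) \<le> K\<^sub>1 * \<bar>w\<bar> ^ 3" for w
        using double_exponential_Taylor[of a C 0 w] a_le \<open>0 < C\<close>
        by (simp add: cosh_kernel_def a_def R_def K\<^sub>1_def exp_of_real mult_ac)
    qed (use \<open>0 < K\<^sub>1\<close> in simp)
    have J: "cmod (J - Q) \<le> 2 * K\<^sub>1 * \<sigma> ^ 3"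
      unfolding J_def Q_def
    proof (rule gaussian_integral_Taylor[OF \<open>0 < \<sigma>\<close>])
      show "(\<lambda>w. cosh_kernel r (y + of_real w)) \<in> borel_measurable borel"
        unfolding cosh_kernel_def cosh_field_def by measurable
      let ?\<alpha> = "of_real r * exp y / 2" and ?\<beta> = "of_real r * exp (- y) / 2"
      have "?\<alpha> + ?\<beta> = a" "?\<alpha> - ?\<beta> = b"
        by (simp_all add: a_def b_def cosh_field_def sinh_field_def field_simps)
      moreover have "?\<alpha> * exp (of_real w) + ?\<beta> * exp (- of_real w) = of_real r * cosh (y + of_real w)" for w
        by (simp add: cosh_field_def exp_add exp_diff exp_minus field_simps)
      ultimately show "cmod (cosh_kernel r (y + of_real w) - (exp (- a) + - b * exp (- a) * of_real w
          + (b\<^sup>2 - a) * exp (- a) / 2 * of_real (w\<^sup>2))) \<le> K\<^sub>1 * \<bar>w\<bar> ^ 3" for w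
        using double_exponential_Taylor[of ?\<alpha> C ?\<beta> w] half[of y] half[of "- y"] \<open>0 < C\<close> \<open>cos (Im y) = c\<close>
        by (simp add: cosh_kernel_def K\<^sub>1_def)
    qed (use \<open>0 < K\<^sub>1\<close> in simp)
    have PQ: "cmod (of_real e * P - Q) \<le> (9 * C ^ 4 + 2 * C ^ 3) * \<sigma> ^ 4"
    proof -
      \<comment> \<open>The terms of order \<open>\<sigma>\<^sup>2\<close> cancel because \<open>a\<^sup>2 - b\<^sup>2 = r\<^sup>2\<close>; what is left has order \<open>\<sigma>\<^sup>4\<close>.\<close>
      define v where "v = \<sigma>\<^sup>2 / 2 * r\<^sup>2"
      have "0 \<le> v" by (simp add: v_def)
      have e1: "\<bar>e - 1\<bar> \<le> v"
        using exp_ge_add_one_self[of "- v"] \<open>0 \<le> v\<close> exp_le_one_iff[of "- v"]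
        unfolding e_def v_def[symmetric] by linarith
      have e2: "\<bar>e - 1 + v\<bar> \<le> v\<^sup>2 / 2"
        using exp_ge_add_one_self[of "- v"] exp_neg_le_quadratic[OF \<open>0 \<le> v\<close>]
        unfolding e_def v_def[symmetric] by linarith
      have b: "b\<^sup>2 = a\<^sup>2 - of_real (r\<^sup>2)"
        by (simp add: a_def b_def power_mult_distrib cosh_square_eq algebra_simps)
      have "of_real e * P - Q = exp (- a) * (of_real (e - 1 + v) + of_real ((e - 1) * (\<sigma>\<^sup>2 / 2)) * (a\<^sup>2 - a))"
        by (simp only: P_def Q_def v_def b) (simp add: field_simps)
      also have "cmod \<dots> \<le> exp (- R) * (v\<^sup>2 / 2 + v * (\<sigma>\<^sup>2 / 2) * ((C * R)\<^sup>2 + C * R))"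
      proof -
        have "cmod (a\<^sup>2 - a) \<le> (C * R)\<^sup>2 + C * R"
          using norm_triangle_ineq4[of "a\<^sup>2" a] power_mono[OF a_le norm_ge_zero, of 2] a_le
          by (simp add: norm_power)
        then have "cmod (of_real ((e - 1) * (\<sigma>\<^sup>2 / 2)) * (a\<^sup>2 - a)) \<le> v * (\<sigma>\<^sup>2 / 2) * ((C * R)\<^sup>2 + C * R)"
          unfolding norm_mult norm_of_real abs_mult using e1 \<open>0 \<le> v\<close> by (intro mult_mono) auto
        moreover have "cmod (of_real (e - 1 + v)) \<le> v\<^sup>2 / 2"
          unfolding norm_of_real by (rule e2)
        ultimately have "cmod (of_real (e - 1 + v) + of_real ((e - 1) * (\<sigma>\<^sup>2 / 2)) * (a\<^sup>2 - a))
            \<le> v\<^sup>2 / 2 + v * (\<sigma>\<^sup>2 / 2) * ((C * R)\<^sup>2 + C * R)"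
          by (intro norm_triangle_le add_mono)
        then show ?thesis
          unfolding norm_mult[of "exp (- a)"] norm_exp_eq_Re uminus_complex.sel R_def[symmetric]
          by (rule mult_left_mono) simp
      qed
      also have "\<dots> \<le> exp (- R) * (\<sigma> ^ 4 / 8 * (C * R) ^ 4 + \<sigma> ^ 4 / 4 * (C * R)\<^sup>2 * ((C * R)\<^sup>2 + C * R))"
      proof -
        have "v\<^sup>2 / 2 = \<sigma> ^ 4 / 8 * r ^ 4" "v * (\<sigma>\<^sup>2 / 2) = \<sigma> ^ 4 / 4 * r\<^sup>2"
          by (simp_all add: v_def power2_eq_square power4_eq_xxxx)
        moreover have "r ^ 4 \<le> (C * R) ^ 4" "r\<^sup>2 \<le> (C * R)\<^sup>2"
          using \<open>r \<le> C * R\<close> \<open>0 < r\<close> by (auto intro: power_mono)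
        ultimately show ?thesis
          using \<open>0 < \<sigma>\<close> \<open>0 < C\<close> \<open>0 \<le> R\<close>
          by (simp only:) (intro mult_left_mono add_mono mult_right_mono; simp)
      qed
      also have "\<dots> = \<sigma> ^ 4 * (3 * C ^ 4 / 8 * (R ^ 4 * exp (- R)) + C ^ 3 / 4 * (R ^ 3 * exp (- R)))"
        by (simp add: power2_eq_square power3_eq_cube power4_eq_xxxx field_simps)
      also have "\<dots> \<le> \<sigma> ^ 4 * (3 * C ^ 4 / 8 * fact 4 + C ^ 3 / 4 * fact 3)"
        using \<open>0 < C\<close> \<open>0 < \<sigma>\<close> \<open>0 \<le> R\<close> by (intro mult_left_mono add_mono power_exp_neg_le_fact) auto
      also have "\<dots> \<le> (9 * C ^ 4 + 2 * C ^ 3) * \<sigma> ^ 4"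
        using \<open>0 < C\<close> \<open>0 < \<sigma>\<close> by (simp add: fact_numeral algebra_simps)
      finally show ?thesis .
    qed
    have "cmod (of_real e * I - J) \<le> cmod (of_real e * (I - P)) + cmod (of_real e * P - Q) + cmod (J - Q)"
    proof -
      have "of_real e * I - J = of_real e * (I - P) + (of_real e * P - Q) - (J - Q)"
        by (simp add: algebra_simps)
      then show ?thesis
        by (metis (no_types) norm_triangle_ineq norm_triangle_ineq4 add_right_mono order_trans)
    qed
    also have "cmod (of_real e * (I - P)) \<le> 2 * K\<^sub>1 * \<sigma> ^ 3"
    proof -
      have "cmod (of_real e * (I - P)) \<le> 1 * cmod (I - P)"
        unfolding norm_mult by (intro mult_right_mono) (auto simp: e_def)
      with I show ?thesis by simp
    qed
    finally have "cmod (of_real e * I - J) \<le> 4 * K\<^sub>1 * \<sigma> ^ 3 + (9 * C ^ 4 + 2 * C ^ 3) * \<sigma> ^ 4"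
      using J PQ by linarith
    also have "\<dots> \<le> K * \<sigma> ^ 3 + K * \<sigma> ^ 4"
      using \<open>0 < C\<close> \<open>0 < K\<^sub>1\<close> \<open>0 < \<sigma>\<close> by (intro add_mono mult_right_mono) (auto simp: K_def)
    finally show ?thesis
      by (simp add: e_def I_def J_def algebra_simps)
  qed
  then show ?thesis by (rule that)
qed

lemma measurable_cosh_kernel [measurable (raw)]:
  assumes [measurable]: "f \<in> borel_measurable N" "g \<in> borel_measurable N"
  shows "(\<lambda>u. cosh_kernel (f u) (g u)) \<in> borel_measurable N"
  unfolding cosh_kernel_def cosh_field_def by measurable

lemma norm_cosh_kernel_le_1:
  assumes "0 \<le> r" "0 \<le> cos (Im y)"
  shows "cmod (cosh_kernel r y) \<le> 1"
  using assms by (simp add: cosh_kernel_def norm_exp_eq_Re Re_cosh_complex)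

section \<open>Gaussian random walks\<close>

lemma (in prob_space) norm_integral_le:
  fixes f :: "'a \<Rightarrow> complex"
  assumes "f \<in> borel_measurable M" "\<And>\<omega>. cmod (f \<omega>) \<le> K"
  shows "cmod (\<integral>\<omega>. f \<omega> \<partial>M) \<le> K"
proof -
  have "cmod (\<integral>\<omega>. f \<omega> \<partial>M) \<le> (\<integral>\<omega>. cmod (f \<omega>) \<partial>M)"
    by (rule integral_norm_bound)
  also have "\<dots> \<le> K"
    using assms by (intro integral_le_const integrable_const_bound[where B = K]) auto
  finally show ?thesis .
qed

locale gaussian_walk = prob_space M
  for M :: "'a measure" +
  fixes X :: "nat \<Rightarrow> 'a \<Rightarrow> real" and n :: nat and \<sigma> :: real
  assumes \<sigma>_pos: "0 < \<sigma>"
    and indep_steps: "indep_vars (\<lambda>_. borel) X {..<n}"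
    and normal_steps: "i < n \<Longrightarrow> distributed M lborel (X i) (normal_density 0 \<sigma>)"
begin

definition walk :: "nat \<Rightarrow> 'a \<Rightarrow> real" where
  "walk k \<omega> = (\<Sum>i<k. X i \<omega>)"

lemma measurable_step: "i < n \<Longrightarrow> X i \<in> borel_measurable M"
  using normal_steps by (auto simp: distributed_def)

lemma measurable_walk: "k \<le> n \<Longrightarrow> walk k \<in> borel_measurable M"
  unfolding walk_def by (intro borel_measurable_sum measurable_step) auto

lemma walk_Suc: "walk (Suc k) \<omega> = walk k \<omega> + X k \<omega>"
  by (simp add: walk_def)

lemma prob_space_gaussian: "prob_space (centred_gaussian \<sigma>)"
  using \<sigma>_pos by (rule prob_space_normal_density)

text \<open>Step \<open>k\<close> is independent of the earlier ones, so it may be integrated out on its own. The past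
enters as the whole vector of steps, not only through the current position, because the discount
factors below depend on all earlier positions.\<close>

lemma integral_next_step:
  fixes \<Phi> :: "(nat \<Rightarrow> real) \<Rightarrow> real \<Rightarrow> complex"
  assumes "k < n"
    and \<Phi>: "case_prod \<Phi> \<in> borel_measurable (PiM {..<k} (\<lambda>_. borel) \<Otimes>\<^sub>M borel)"
    and bounded: "\<And>u w. cmod (\<Phi> u w) \<le> K"
  shows "(\<integral>\<omega>. \<Phi> (\<lambda>i\<in>{..<k}. X i \<omega>) (X k \<omega>) \<partial>M)
    = (\<integral>\<omega>. (\<integral>w. \<Phi> (\<lambda>i\<in>{..<k}. X i \<omega>) w \<partial>centred_gaussian \<sigma>) \<partial>M)"
proof -
  let ?P = "PiM {..<k} (\<lambda>_. borel :: real measure)" and ?N = "centred_gaussian \<sigma>"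
  let ?U = "\<lambda>\<omega>. \<lambda>i\<in>{..<k}. X i \<omega>"
  let ?Q = "PiM {k} (\<lambda>_. borel :: real measure)" and ?V = "\<lambda>\<omega>. \<lambda>i\<in>{k}. X i \<omega>"
  have indep: "indep_var ?P ?U ?Q ?V"
    using \<open>k < n\<close> by (intro indep_var_restrict[OF indep_steps]) auto
  then have U: "?U \<in> measurable M ?P" and V: "?V \<in> measurable M ?Q"
    and UV: "distr M (?P \<Otimes>\<^sub>M ?Q) (\<lambda>\<omega>. (?U \<omega>, ?V \<omega>)) = distr M ?P ?U \<Otimes>\<^sub>M distr M ?Q ?V"
    by (simp_all add: indep_var_distribution_eq)
  note [measurable] = \<Phi> U V measurable_step[OF \<open>k < n\<close>]
  have N: "distr M borel (X k) = ?N"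
    using distributed_distr_eq_density[OF normal_steps[OF \<open>k < n\<close>]] by (simp cong: distr_cong)
  interpret U: prob_space "distr M ?P ?U"
    using U by (rule prob_space_distr)
  interpret V: prob_space "distr M ?Q ?V"
    using V by (rule prob_space_distr)
  interpret N: prob_space ?N
    by (rule prob_space_gaussian)
  interpret pair_prob_space "distr M ?P ?U" "distr M ?Q ?V" ..
  have [measurable]: "(\<lambda>v. v k) \<in> borel_measurable ?Q"
    by (rule measurable_component_singleton) simp
  have \<Phi>_section: "\<Phi> u \<in> borel_measurable borel" if "u \<in> space ?P" for u
    using measurable_Pair2[OF \<Phi> that] by simp
  have "(\<integral>\<omega>. \<Phi> (?U \<omega>) (X k \<omega>) \<partial>M) = (\<integral>z. \<Phi> (fst z) (snd z k) \<partial>distr M (?P \<Otimes>\<^sub>M ?Q) (\<lambda>\<omega>. (?U \<omega>, ?V \<omega>)))"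
    by (subst integral_distr) auto
  also note UV
  also have "(\<integral>z. \<Phi> (fst z) (snd z k) \<partial>(distr M ?P ?U \<Otimes>\<^sub>M distr M ?Q ?V))
      = (\<integral>u. (\<integral>v. \<Phi> u (v k) \<partial>distr M ?Q ?V) \<partial>distr M ?P ?U)"
    by (subst integral_fst'[symmetric])
      (auto intro!: P.integrable_const_bound[where B = K] bounded simp: split_beta')
  also have "\<dots> = (\<integral>u. (\<integral>w. \<Phi> u w \<partial>?N) \<partial>distr M ?P ?U)"
  proof (rule Bochner_Integration.integral_cong[OF refl])
    fix u assume "u \<in> space (distr M ?P ?U)"
    then have [measurable]: "\<Phi> u \<in> borel_measurable borel"
      by (intro \<Phi>_section) simp
    show "(\<integral>v. \<Phi> u (v k) \<partial>distr M ?Q ?V) = (\<integral>w. \<Phi> u w \<partial>?N)"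
      by (simp add: integral_distr flip: N)
  qed
  also have "\<dots> = (\<integral>\<omega>. (\<integral>w. \<Phi> (?U \<omega>) w \<partial>?N) \<partial>M)"
    by (subst integral_distr) (auto intro!: N.borel_measurable_lebesgue_integral)
  finally show ?thesis .
qed

context
  fixes x :: complex and c :: real
  assumes c: "cos (Im x) = c" "0 < c"
begin

text \<open>The heat semigroup acting in the angle variable, started at \<open>x\<close>, with the walk itself as the
random motion. Expressing it through the walk avoids convolving Gaussian densities.\<close>

definition heat :: "nat \<Rightarrow> real \<Rightarrow> complex" where
  "heat m r = (\<integral>\<omega>. cosh_kernel r (x + of_real (walk m \<omega>)) \<partial>M)"

lemma measurable_heat [measurable]: "m \<le> n \<Longrightarrow> heat m \<in> borel_measurable borel"
  unfolding heat_def[abs_def]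
  by (rule borel_measurable_lebesgue_integral) (use measurable_walk in measurable)

lemma norm_heat_le_1:
  assumes "0 \<le> r" "m \<le> n"
  shows "cmod (heat m r) \<le> 1"
  unfolding heat_def using measurable_walk[OF \<open>m \<le> n\<close>] assms c
  by (intro norm_integral_le norm_cosh_kernel_le_1) auto

lemma heat_Suc:
  assumes "m < n" "0 < r"
  shows "heat (Suc m) r
    = (\<integral>\<omega>. (\<integral>w. cosh_kernel r (x + of_real (walk m \<omega>) + of_real w) \<partial>centred_gaussian \<sigma>) \<partial>M)"
proof -
  have "(\<integral>\<omega>. cosh_kernel r (x + of_real (\<Sum>i<m. (\<lambda>i\<in>{..<m}. X i \<omega>) i) + of_real (X m \<omega>)) \<partial>M)
    = (\<integral>\<omega>. (\<integral>w. cosh_kernel r (x + of_real (\<Sum>i<m. (\<lambda>i\<in>{..<m}. X i \<omega>) i) + of_real w) \<partial>centred_gaussian \<sigma>) \<partial>M)"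
    using assms c
    by (intro integral_next_step[where K = 1]) (auto intro!: norm_cosh_kernel_le_1)
  then show ?thesis
    by (simp add: heat_def walk_def add.assoc)
qed

lemma integral_heat:
  assumes "m \<le> n" "0 < r"
  shows "(\<integral>w. heat m (r * exp w) \<partial>centred_gaussian \<sigma>)
    = (\<integral>\<omega>. (\<integral>w. cosh_kernel (r * exp w) (x + of_real (walk m \<omega>)) \<partial>centred_gaussian \<sigma>) \<partial>M)"
proof -
  interpret N: prob_space "centred_gaussian \<sigma>"
    by (rule prob_space_gaussian)
  interpret pair_prob_space M "centred_gaussian \<sigma>" ..
  note [measurable] = measurable_walk[OF \<open>m \<le> n\<close>]
  show ?thesis
    unfolding heat_def using assms c
    by (intro Fubini_integral P.integrable_const_bound[where B = 1])
      (auto simp: split_beta' intro!: norm_cosh_kernel_le_1)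
qed

context
  fixes \<epsilon> :: real
  assumes step: "\<And>r y. \<lbrakk>0 < r; cos (Im y) = c\<rbrakk> \<Longrightarrow>
      cmod (of_real (exp (- (\<sigma>\<^sup>2 / 2 * r\<^sup>2))) * (\<integral>w. cosh_kernel (r * exp w) y \<partial>centred_gaussian \<sigma>)
        - (\<integral>w. cosh_kernel r (y + of_real w) \<partial>centred_gaussian \<sigma>)) \<le> \<epsilon>"
begin

text \<open>The one-step estimate survives averaging over the angle: a step in the scale commutes with the
steps in the angle (Fubini), and the estimate is uniform over the angles \<open>x + W\<close> reached.\<close>

lemma heat_exchange:
  assumes "m < n" "0 < r"
  shows "cmod (of_real (exp (- (\<sigma>\<^sup>2 / 2 * r\<^sup>2))) * (\<integral>w. heat m (r * exp w) \<partial>centred_gaussian \<sigma>)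
    - heat (Suc m) r) \<le> \<epsilon>"
proof -
  let ?N = "centred_gaussian \<sigma>" and ?e = "of_real (exp (- (\<sigma>\<^sup>2 / 2 * r\<^sup>2))) :: complex"
  interpret N: prob_space ?N
    by (rule prob_space_gaussian)
  note [measurable] = measurable_walk[OF less_imp_le[OF \<open>m < n\<close>]]
  define I J where "I = (\<lambda>\<omega>. \<integral>w. cosh_kernel (r * exp w) (x + of_real (walk m \<omega>)) \<partial>?N)"
    and "J = (\<lambda>\<omega>. \<integral>w. cosh_kernel r (x + of_real (walk m \<omega>) + of_real w) \<partial>?N)"
  have [measurable]: "I \<in> borel_measurable M" "J \<in> borel_measurable M"
    unfolding I_def J_def by measurable
  have bounded: "cmod (I \<omega>) \<le> 1" "cmod (J \<omega>) \<le> 1" for \<omega>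
    unfolding I_def J_def using c \<open>0 < r\<close>
    by (auto intro!: N.norm_integral_le norm_cosh_kernel_le_1)
  have int: "integrable M I" "integrable M J"
    using bounded by (auto intro!: integrable_const_bound[where B = 1])
  have "?e * (\<integral>w. heat m (r * exp w) \<partial>?N) - heat (Suc m) r = (\<integral>\<omega>. ?e * I \<omega> - J \<omega> \<partial>M)"
    using int assms by (simp add: integral_heat heat_Suc flip: I_def J_def)
  also have "cmod \<dots> \<le> \<epsilon>"
    unfolding I_def J_def using c \<open>0 < r\<close> by (intro norm_integral_le step) auto
  finally show ?thesis .
qed

text \<open>Interpolation: let \<open>T k\<close> make \<open>k\<close> discounted steps in the scale followed by \<open>n - k\<close> steps in the
angle. Passing from \<open>T k\<close> to \<open>T (k + 1)\<close> exchanges one step, which costs at most \<open>\<epsilon>\<close> since the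
accumulated discount is at most one.\<close>

lemma walk_exchange_error:
  assumes "0 < r"
  shows "cmod ((\<integral>\<omega>. of_real (exp (- (\<sigma>\<^sup>2 / 2 * (\<Sum>j<n. (r * exp (walk j \<omega>))\<^sup>2)))) * cosh_kernel (r * exp (walk n \<omega>)) x \<partial>M)
    - (\<integral>\<omega>. cosh_kernel r (x + of_real (walk n \<omega>)) \<partial>M)) \<le> real n * \<epsilon>"
proof -
  let ?N = "centred_gaussian \<sigma>"
  interpret N: prob_space ?N
    by (rule prob_space_gaussian)
  define weight :: "nat \<Rightarrow> 'a \<Rightarrow> complex" where
    "weight = (\<lambda>k \<omega>. of_real (exp (- (\<sigma>\<^sup>2 / 2 * (\<Sum>j<k. (r * exp (walk j \<omega>))\<^sup>2)))))"
  define T where "T = (\<lambda>k. \<integral>\<omega>. weight k \<omega> * heat (n - k) (r * exp (walk k \<omega>)) \<partial>M)"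
  have weight_le: "cmod (weight k \<omega>) \<le> 1" for k \<omega>
    by (simp add: weight_def sum_nonneg)
  have weight [measurable]: "weight k \<in> borel_measurable M" if "k \<le> n" for k
  proof -
    have [measurable]: "(\<lambda>\<omega>. \<Sum>j<k. (r * exp (walk j \<omega>))\<^sup>2) \<in> borel_measurable M"
    proof (rule borel_measurable_sum)
      fix j assume "j \<in> {..<k}"
      then have [measurable]: "walk j \<in> borel_measurable M"
        using that by (intro measurable_walk) auto
      show "(\<lambda>\<omega>. (r * exp (walk j \<omega>))\<^sup>2) \<in> borel_measurable M"
        by measurable
    qed
    show ?thesis
      unfolding weight_def by measurable
  qed
  have "cmod (T (Suc k) - T k) \<le> \<epsilon>" if "k < n" for k
  proof -
    define m where "m = n - Suc k"
    have m: "m < n" "n - k = Suc m" "n - Suc k = m"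
      using \<open>k < n\<close> by (auto simp: m_def)
    define \<rho> where "\<rho> = (\<lambda>\<omega>. r * exp (walk k \<omega>))"
    have \<rho>_pos: "0 < \<rho> \<omega>" for \<omega>
      using \<open>0 < r\<close> by (simp add: \<rho>_def)
    define e where "e = (\<lambda>\<omega>. of_real (exp (- (\<sigma>\<^sup>2 / 2 * (\<rho> \<omega>)\<^sup>2))) :: complex)"
    define H where "H = (\<lambda>\<omega>. \<integral>w. heat m (\<rho> \<omega> * exp w) \<partial>?N)"
    note [measurable] = weight[OF less_imp_le[OF \<open>k < n\<close>]] measurable_heat[OF less_imp_le[OF \<open>m < n\<close>]]
      measurable_heat[OF Suc_leI[OF \<open>m < n\<close>]] measurable_walk[OF less_imp_le[OF \<open>k < n\<close>]]
    have [measurable]: "\<rho> \<in> borel_measurable M"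
      unfolding \<rho>_def by measurable
    have [measurable]: "e \<in> borel_measurable M" "H \<in> borel_measurable M"
      unfolding e_def H_def by measurable
    have H_le: "cmod (H \<omega>) \<le> 1" for \<omega>
      unfolding H_def using \<rho>_pos[of \<omega>] \<open>m < n\<close>
      by (intro N.norm_integral_le norm_heat_le_1) auto
    have "T (Suc k) = (\<integral>\<omega>. weight k \<omega> * e \<omega> * H \<omega> \<partial>M)"
    proof -
      let ?U = "\<lambda>\<omega>. \<lambda>i\<in>{..<k}. X i \<omega>"
      \<comment> \<open>The integrand of \<open>T (Suc k)\<close> as a function of the first \<open>k\<close> steps and the next one.\<close>
      define \<Phi> :: "(nat \<Rightarrow> real) \<Rightarrow> real \<Rightarrow> complex" where
        "\<Phi> = (\<lambda>u w. of_real (exp (- (\<sigma>\<^sup>2 / 2 * (\<Sum>j<Suc k. (r * exp (\<Sum>i<j. u i))\<^sup>2))))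
          * heat m (r * exp (\<Sum>i<k. u i) * exp w))"
      have walk: "(\<Sum>i<j. ?U \<omega> i) = walk j \<omega>" if "j \<le> k" for j \<omega>
        using that by (auto simp: walk_def intro!: sum.cong)
      have exp_split: "exp (- (\<sigma>\<^sup>2 / 2 * (A + A'))) = exp (- (\<sigma>\<^sup>2 / 2 * A)) * exp (- (\<sigma>\<^sup>2 / 2 * A'))" for A A'
        by (simp add: distrib_left flip: exp_add)
      have \<Phi>: "\<Phi> (?U \<omega>) w = weight k \<omega> * e \<omega> * heat m (\<rho> \<omega> * exp w)" for \<omega> w
      proof -
        have "(\<Sum>j<Suc k. (r * exp (\<Sum>i<j. ?U \<omega> i))\<^sup>2) = (\<Sum>j<k. (r * exp (walk j \<omega>))\<^sup>2) + (\<rho> \<omega>)\<^sup>2"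
          by (simp add: walk_def \<rho>_def)
        then show ?thesis
          unfolding \<Phi>_def by (simp only: walk[OF order_refl] exp_split)
            (simp add: weight_def e_def \<rho>_def)
      qed
      have "T (Suc k) = (\<integral>\<omega>. \<Phi> (?U \<omega>) (X k \<omega>) \<partial>M)"
        unfolding T_def \<Phi> m weight_def e_def \<rho>_def sum.lessThan_Suc exp_split walk_Suc exp_add
        by (simp add: mult.assoc)
      also have "\<dots> = (\<integral>\<omega>. (\<integral>w. \<Phi> (?U \<omega>) w \<partial>?N) \<partial>M)"
      proof (rule integral_next_step[OF \<open>k < n\<close>])
        have sums: "(\<lambda>u. \<Sum>i<j. u i) \<in> borel_measurable (PiM {..<k} (\<lambda>_. borel :: real measure))" if "j \<le> k" for j
          using that by (intro borel_measurable_sum measurable_component_singleton) auto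
        show "case_prod \<Phi> \<in> borel_measurable (PiM {..<k} (\<lambda>_. borel) \<Otimes>\<^sub>M borel)"
        proof -
          have [measurable]: "(\<lambda>z. \<Sum>j<Suc k. (r * exp (\<Sum>i<j. fst z i))\<^sup>2)
              \<in> borel_measurable (PiM {..<k} (\<lambda>_. borel) \<Otimes>\<^sub>M (borel :: real measure))"
          proof (rule borel_measurable_sum)
            fix j assume "j \<in> {..<Suc k}"
            then have [measurable]: "(\<lambda>u. \<Sum>i<j. u i) \<in> borel_measurable (PiM {..<k} (\<lambda>_. borel :: real measure))"
              by (intro sums) auto
            show "(\<lambda>z. (r * exp (\<Sum>i<j. fst z i))\<^sup>2)
                \<in> borel_measurable (PiM {..<k} (\<lambda>_. borel) \<Otimes>\<^sub>M (borel :: real measure))"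
              by measurable
          qed
          note [measurable] = sums[of k, OF order_refl]
          show ?thesis
            unfolding \<Phi>_def split_beta' by measurable
        qed
        show "cmod (\<Phi> u w) \<le> 1" for u w
          unfolding \<Phi>_def norm_mult using \<open>0 < r\<close> \<open>m < n\<close>
          by (intro mult_le_one norm_heat_le_1) (auto simp del: sum.lessThan_Suc intro!: sum_nonneg mult_nonneg_nonneg)
      qed
      finally show ?thesis
        by (simp add: \<Phi> H_def)
    qed
    then have "T (Suc k) - T k = (\<integral>\<omega>. weight k \<omega> * (e \<omega> * H \<omega> - heat (Suc m) (\<rho> \<omega>)) \<partial>M)"
    proof -
      have bounded: "cmod (weight k \<omega> * e \<omega> * H \<omega>) \<le> 1" "cmod (weight k \<omega> * heat (Suc m) (\<rho> \<omega>)) \<le> 1" for \<omega>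
        unfolding norm_mult using weight_le H_le \<rho>_pos[of \<omega>] \<open>m < n\<close>
        by (auto intro!: mult_le_one norm_heat_le_1 mult_nonneg_nonneg simp: e_def)
      have "integrable M (\<lambda>\<omega>. weight k \<omega> * e \<omega> * H \<omega>)" "integrable M (\<lambda>\<omega>. weight k \<omega> * heat (Suc m) (\<rho> \<omega>))"
        by (rule integrable_const_bound[where B = 1], use bounded in simp, measurable)+
      moreover have "T k = (\<integral>\<omega>. weight k \<omega> * heat (Suc m) (\<rho> \<omega>) \<partial>M)"
        by (simp add: T_def m \<rho>_def)
      ultimately show ?thesis
        using \<open>T (Suc k) = _\<close> by (simp add: right_diff_distrib mult.assoc)
    qed
    also have "cmod \<dots> \<le> \<epsilon>"
    proof (rule norm_integral_le)
      show "cmod (weight k \<omega> * (e \<omega> * H \<omega> - heat (Suc m) (\<rho> \<omega>))) \<le> \<epsilon>" for \<omega>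
        using mult_mono[OF weight_le heat_exchange[OF \<open>m < n\<close> \<rho>_pos]]
        by (simp add: norm_mult e_def H_def)
    qed measurable
    finally show ?thesis .
  qed
  then have "cmod (\<Sum>k<n. T (Suc k) - T k) \<le> (\<Sum>k<n. \<epsilon>)"
    by (intro sum_norm_le) auto
  then have "cmod (T n - T 0) \<le> real n * \<epsilon>"
    by (simp add: sum_lessThan_telescope)
  moreover have "T 0 = (\<integral>\<omega>. cosh_kernel r (x + of_real (walk n \<omega>)) \<partial>M)"
    by (simp add: T_def weight_def walk_def heat_def prob_space)
  moreover have "T n = (\<integral>\<omega>. weight n \<omega> * cosh_kernel (r * exp (walk n \<omega>)) x \<partial>M)"
    by (simp add: T_def heat_def walk_def prob_space)
  ultimately show ?thesis
    by (simp add: weight_def)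
qed

end

end

end

section \<open>From random walks to Brownian motion\<close>

lemma left_Riemann_sums_tendsto:
  fixes g :: "real \<Rightarrow> real"
  assumes "0 < t" and g: "continuous_on {0..t} g"
  shows "(\<lambda>n. \<Sum>j<n. t / n * g (real j * (t / n))) \<longlonglongrightarrow> (LBINT u:{0..t}. g u)"
proof (rule LIMSEQ_I)
  fix e :: real assume "0 < e"
  define e' where "e' = e / (2 * t)"
  have "0 < e'" "t * e' < e"
    using \<open>0 < e\<close> \<open>0 < t\<close> by (auto simp: e'_def)
  have "uniformly_continuous_on {0..t} g"
    using g by (rule compact_uniformly_continuous) simp
  with \<open>0 < e'\<close> obtain d where "0 < d"
    and d: "\<And>u v. \<lbrakk>u \<in> {0..t}; v \<in> {0..t}; dist v u < d\<rbrakk> \<Longrightarrow> dist (g v) (g u) < e'"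
    unfolding uniformly_continuous_on_def by blast
  obtain N :: nat where N: "t / d < real N"
    using reals_Archimedean2 by blast
  have "norm ((\<Sum>j<n. t / n * g (real j * (t / n))) - (LBINT u:{0..t}. g u)) < e" if "N \<le> n" for n
  proof -
    define h where "h = t / real n"
    have "t / d < real n"
      using N that by simp
    moreover have "0 < t / d"
      using \<open>0 < t\<close> \<open>0 < d\<close> by simp
    ultimately have "0 < real n" "t / d < real n"
      by linarith+
    then have "0 < h" "h < d" "real n * h = t"
      using \<open>0 < t\<close> \<open>0 < d\<close> by (auto simp: h_def field_simps)
    have le_t: "real k * h \<le> t" if "k \<le> n" for k
      using that \<open>0 < h\<close> \<open>real n * h = t\<close> by (metis mult_right_mono of_nat_le_iff less_imp_le)
    have cont: "continuous_on {a..b} g" if "0 \<le> a" "b \<le> t" for a b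
      using that by (intro continuous_on_subset[OF g]) auto
    have "norm (integral {0..real k * h} g - (\<Sum>j<k. h * g (real j * h))) \<le> real k * (h * e')" if "k \<le> n" for k
      using that
    proof (induction k)
      case 0
      then show ?case by simp
    next
      case (Suc k)
      let ?a = "real k * h" and ?b = "real (Suc k) * h"
      have ab: "0 \<le> ?a" "?a \<le> ?b" "?b \<le> t" "?b - ?a = h"
        using \<open>0 < h\<close> le_t[OF Suc.prems] by (auto simp: algebra_simps)
      have split: "integral {0..?b} g = integral {0..?a} g + integral {?a..?b} g"
        using ab by (intro Henstock_Kurzweil_Integration.integral_combine[symmetric] integrable_continuous_real cont) auto
      have "integral {?a..?b} g - h * g ?a = integral {?a..?b} (\<lambda>u. g u - g ?a)"
        using ab by (subst Henstock_Kurzweil_Integration.integral_diff)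
          (auto intro!: integrable_continuous_real cont)
      also have "norm \<dots> \<le> e' * (?b - ?a)"
      proof (rule integral_bound)
        show "norm (g u - g ?a) \<le> e'" if "u \<in> {?a..?b}" for u
        proof -
          from that have "?a \<le> u" "u \<le> ?b"
            by auto
          with ab \<open>h < d\<close> have "0 \<le> u" "u \<le> t" "?a \<le> t" "\<bar>u - ?a\<bar> < d"
            by linarith+
          then have "dist (g u) (g ?a) < e'"
            using ab by (intro d) (auto simp: dist_real_def)
          then show "norm (g u - g ?a) \<le> e'"
            by (simp add: dist_real_def)
        qed
      qed (use ab in \<open>auto intro!: continuous_intros cont\<close>)
      finally have "norm (integral {?a..?b} g - h * g ?a) \<le> h * e'"
        using ab by (simp add: mult.commute)
      moreover have "norm (integral {0..?a} g - (\<Sum>j<k. h * g (real j * h))) \<le> real k * (h * e')"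
        using Suc by simp
      moreover have "real (Suc k) * (h * e') = real k * (h * e') + h * e'"
        by (simp add: algebra_simps)
      ultimately show ?case
        unfolding split sum.lessThan_Suc real_norm_def by linarith
    qed
    from this[OF order_refl] have "norm (integral {0..t} g - (\<Sum>j<n. h * g (real j * h))) \<le> t * e'"
      by (simp add: \<open>real n * h = t\<close> flip: mult.assoc)
    moreover have "(LBINT u:{0..t}. g u) = integral {0..t} g"
      using g by (intro set_borel_integral_eq_integral borel_integrable_atLeastAtMost')
    ultimately show ?thesis
      using \<open>t * e' < e\<close> unfolding h_def[symmetric] by (simp add: norm_minus_commute)
  qed
  then show "\<exists>N. \<forall>n\<ge>N. norm ((\<Sum>j<n. t / n * g (real j * (t / n))) - (LBINT u:{0..t}. g u)) < e"
    by blast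
qed

context standard_brownian_motion
begin

lemma gaussian_walk_grid:
  assumes "0 < h"
  shows "gaussian_walk M (\<lambda>i \<omega>. B (real (Suc i) * h) \<omega> - B (real i * h) \<omega>) n (sqrt h)"
proof
  show "0 < sqrt h"
    using assms by simp
  show "indep_vars (\<lambda>_. borel) (\<lambda>i \<omega>. B (real (Suc i) * h) \<omega> - B (real i * h) \<omega>) {..<n}"
    using assms by (intro independent_increments) auto
  show "distributed M lborel (\<lambda>\<omega>. B (real (Suc i) * h) \<omega> - B (real i * h) \<omega>) (normal_density 0 (sqrt h))" for i
    using normal_increments[of "real i * h" "real (Suc i) * h"] assms
    by (simp add: algebra_simps)
qed

lemma walk_grid:
  assumes "0 < h"
  shows "gaussian_walk.walk (\<lambda>i \<omega>. B (real (Suc i) * h) \<omega> - B (real i * h) \<omega>) k \<omega> = B (real k * h) \<omega> - B 0 \<omega>"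
  using gaussian_walk.walk_def[OF gaussian_walk_grid[OF assms], of k \<omega>]
    sum_lessThan_telescope[of "\<lambda>i. B (real i * h) \<omega>" k] by simp

lemma exp_path_Riemann:
  assumes "0 < t" "\<omega> \<in> space M"
  shows "(\<lambda>n. \<Sum>j<n. t / n * exp (2 * B (real j * (t / n)) \<omega>)) \<longlonglongrightarrow> (LBINT u:{0..t}. exp (2 * B u \<omega>))"
  using assms continuous_paths[of \<omega>]
  by (intro left_Riemann_sums_tendsto) (auto intro!: continuous_intros intro: continuous_on_subset)

lemma measurable_integral_exp_path:
  assumes "0 < t"
  shows "(\<lambda>\<omega>. LBINT u:{0..t}. exp (2 * B u \<omega>)) \<in> borel_measurable M"
proof (rule borel_measurable_LIMSEQ_real)
  show "(\<lambda>n. \<Sum>j<n. t / n * exp (2 * B (real j * (t / n)) \<omega>)) \<longlonglongrightarrow> (LBINT u:{0..t}. exp (2 * B u \<omega>))"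
    if "\<omega> \<in> space M" for \<omega>
    using assms that by (rule exp_path_Riemann)
  show "(\<lambda>\<omega>. \<Sum>j<n. t / n * exp (2 * B (real j * (t / n)) \<omega>)) \<in> borel_measurable M" for n
  proof -
    have [measurable]: "B (real j * (t / n)) \<in> borel_measurable M" for j
      using assms by (intro measurable_at) simp
    show ?thesis
      by measurable
  qed
qed

text \<open>The transform for every complex angle \<open>x\<close> with \<^term>\<open>0 < cos (Im x)\<close>. Sample the path at
\<open>n\<close> equidistant times. The discretised left-hand side converges by dominated convergence, all
integrands being bounded by one, while \<open>n\<close> exchanges with \<open>\<sigma>\<^sup>2 = t / n\<close> cost
\<open>n K (\<sigma>\<^sup>3 + \<sigma>\<^sup>4) = K t (\<sigma> + \<sigma>\<^sup>2)\<close> in total, which tends to zero.\<close>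

theorem laplace_transform_exp_functional:
  assumes "0 \<le> t" "0 < l" "0 < cos (Im x)"
  shows "(\<integral>\<omega>. of_real (exp (- (l\<^sup>2 / 2 * (LBINT u:{0..t}. exp (2 * B u \<omega>))))) * cosh_kernel (l * exp (B t \<omega>)) x \<partial>M)
    = (\<integral>\<omega>. cosh_kernel l (x + of_real (B t \<omega>)) \<partial>M)"
proof (cases "t = 0")
  case True
  have [measurable]: "B 0 \<in> borel_measurable M"
    by (rule measurable_at) simp
  have "(LBINT u:{0}. exp (2 * B u \<omega>)) = 0" for \<omega>
    unfolding set_lebesgue_integral_def
    by (rule integral_eq_zero_AE) (use AE_lborel_singleton[of 0] in eventually_elim, simp)
  note point = this
  show ?thesis
  proof (rule integral_cong_AE)
    show "AE \<omega> in M. of_real (exp (- (l\<^sup>2 / 2 * (LBINT u:{0..t}. exp (2 * B u \<omega>))))) * cosh_kernel (l * exp (B t \<omega>)) x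
        = cosh_kernel l (x + of_real (B t \<omega>))"
      using start_zero by eventually_elim (simp add: True point)
  qed (simp_all add: True point)
next
  case False
  with \<open>0 \<le> t\<close> have "0 < t" by simp
  define I where "I = (\<lambda>\<omega>. LBINT u:{0..t}. exp (2 * B u \<omega>))"
  define S where "S = (\<lambda>n \<omega>. \<Sum>j<n. t / real n * exp (2 * B (real j * (t / real n)) \<omega>))"
  define D where "D = (\<lambda>s \<omega>. of_real (exp (- (l\<^sup>2 / 2 * s))) * cosh_kernel (l * exp (B t \<omega>)) x)"
  define V where "V = (\<integral>\<omega>. cosh_kernel l (x + of_real (B t \<omega>)) \<partial>M)"
  have [measurable]: "B t \<in> borel_measurable M" "B 0 \<in> borel_measurable M" "I \<in> borel_measurable M"
    using \<open>0 < t\<close> unfolding I_def by (auto intro!: measurable_at measurable_integral_exp_path)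
  have grid [measurable]: "B (real j * (t / real n)) \<in> borel_measurable M" for j n
    using \<open>0 < t\<close> by (intro measurable_at) simp
  have [measurable]: "S n \<in> borel_measurable M" for n
    unfolding S_def by measurable
  have "(\<lambda>n. \<integral>\<omega>. D (S n \<omega>) \<omega> \<partial>M) \<longlonglongrightarrow> (\<integral>\<omega>. D (I \<omega>) \<omega> \<partial>M)"
  proof (rule integral_dominated_convergence[where w = "\<lambda>_. 1"])
    show "AE \<omega> in M. (\<lambda>n. D (S n \<omega>) \<omega>) \<longlonglongrightarrow> D (I \<omega>) \<omega>"
      unfolding D_def S_def I_def
      by (intro AE_I2 tendsto_intros exp_path_Riemann \<open>0 < t\<close>)
    show "AE \<omega> in M. norm (D (S n \<omega>) \<omega>) \<le> 1" for n
    proof (rule AE_I2)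
      fix \<omega>
      have "0 \<le> S n \<omega>"
        using \<open>0 < t\<close> by (auto simp: S_def intro!: sum_nonneg)
      then show "norm (D (S n \<omega>) \<omega>) \<le> 1"
        unfolding D_def norm_mult using assms
        by (intro mult_le_one norm_cosh_kernel_le_1) auto
    qed
  qed (auto simp: D_def)
  moreover have "(\<lambda>n. \<integral>\<omega>. D (S n \<omega>) \<omega> \<partial>M) \<longlonglongrightarrow> V"
  proof -
    obtain K where K: "\<And>r y \<sigma>. \<lbrakk>0 < r; cos (Im y) = cos (Im x); 0 < \<sigma>\<rbrakk> \<Longrightarrow>
        cmod (of_real (exp (- (\<sigma>\<^sup>2 / 2 * r\<^sup>2))) * (\<integral>w. cosh_kernel (r * exp w) y \<partial>centred_gaussian \<sigma>)
          - (\<integral>w. cosh_kernel r (y + of_real w) \<partial>centred_gaussian \<sigma>)) \<le> K * (\<sigma> ^ 3 + \<sigma> ^ 4)"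
      using gaussian_step_exchange[OF \<open>0 < cos (Im x)\<close>] by blast
    have "cmod ((\<integral>\<omega>. D (S n \<omega>) \<omega> \<partial>M) - V) \<le> K * t * (sqrt (t / n) + t / n)" if "0 < n" for n
    proof -
      define h where "h = t / real n"
      have "0 < h" "real n * h = t"
        using \<open>0 < t\<close> \<open>0 < n\<close> by (auto simp: h_def)
      interpret walk: gaussian_walk M "\<lambda>i \<omega>. B (real (Suc i) * h) \<omega> - B (real i * h) \<omega>" n "sqrt h"
        using \<open>0 < h\<close> by (rule gaussian_walk_grid)
      have "cmod ((\<integral>\<omega>. of_real (exp (- ((sqrt h)\<^sup>2 / 2 * (\<Sum>j<n. (l * exp (walk.walk j \<omega>))\<^sup>2)))) * cosh_kernel (l * exp (walk.walk n \<omega>)) x \<partial>M)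
          - (\<integral>\<omega>. cosh_kernel l (x + of_real (walk.walk n \<omega>)) \<partial>M)) \<le> real n * (K * (sqrt h ^ 3 + sqrt h ^ 4))"
        using assms \<open>0 < h\<close> by (intro walk.walk_exchange_error K) auto
      also have "(\<integral>\<omega>. cosh_kernel l (x + of_real (walk.walk n \<omega>)) \<partial>M) = V"
        unfolding V_def walk_grid[OF \<open>0 < h\<close>] \<open>real n * h = t\<close>
        by (rule integral_cong_AE) (use start_zero in \<open>auto elim!: eventually_mono\<close>)
      also have "(\<integral>\<omega>. of_real (exp (- ((sqrt h)\<^sup>2 / 2 * (\<Sum>j<n. (l * exp (walk.walk j \<omega>))\<^sup>2)))) * cosh_kernel (l * exp (walk.walk n \<omega>)) x \<partial>M)
          = (\<integral>\<omega>. D (S n \<omega>) \<omega> \<partial>M)"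
      proof (rule integral_cong_AE)
        note [measurable] = grid[of _ n, folded h_def]
        show "(\<lambda>\<omega>. of_real (exp (- ((sqrt h)\<^sup>2 / 2 * (\<Sum>j<n. (l * exp (walk.walk j \<omega>))\<^sup>2)))) * cosh_kernel (l * exp (walk.walk n \<omega>)) x) \<in> borel_measurable M"
          unfolding walk_grid[OF \<open>0 < h\<close>] by measurable
        show "(\<lambda>\<omega>. D (S n \<omega>) \<omega>) \<in> borel_measurable M"
          unfolding D_def by measurable
        show "AE \<omega> in M. of_real (exp (- ((sqrt h)\<^sup>2 / 2 * (\<Sum>j<n. (l * exp (walk.walk j \<omega>))\<^sup>2)))) * cosh_kernel (l * exp (walk.walk n \<omega>)) x = D (S n \<omega>) \<omega>"
          using start_zero
        proof eventually_elim
          case (elim \<omega>)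
          have "(sqrt h)\<^sup>2 / 2 * (\<Sum>j<n. (l * exp (walk.walk j \<omega>))\<^sup>2) = l\<^sup>2 / 2 * S n \<omega>"
            unfolding walk_grid[OF \<open>0 < h\<close>] S_def h_def[symmetric] sum_distrib_left using elim \<open>0 < h\<close>
            by (intro sum.cong) (auto simp: power_mult_distrib exp_double)
          then show ?case
            unfolding D_def walk_grid[OF \<open>0 < h\<close>] \<open>real n * h = t\<close> by (simp add: elim)
        qed
      qed
      also have "real n * (K * (sqrt h ^ 3 + sqrt h ^ 4)) = K * (real n * h) * (sqrt h + h)"
      proof -
        have "sqrt h ^ 3 = h * sqrt h" "sqrt h ^ 4 = h * h"
          using \<open>0 < h\<close> by (simp_all add: power3_eq_cube power4_eq_xxxx)
        then show ?thesis by (simp add: algebra_simps)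
      qed
      finally have "cmod ((\<integral>\<omega>. D (S n \<omega>) \<omega> \<partial>M) - V) \<le> K * t * (sqrt h + h)"
        unfolding \<open>real n * h = t\<close> .
      then show ?thesis
        unfolding h_def .
    qed
    then have "\<forall>\<^sub>F n in sequentially. norm ((\<integral>\<omega>. D (S n \<omega>) \<omega> \<partial>M) - V) \<le> K * t * (sqrt (t / n) + t / n)"
      using eventually_gt_at_top[of 0] by (rule eventually_mono[rotated])
    moreover have "(\<lambda>n. K * t * (sqrt (t / real n) + t / real n)) \<longlonglongrightarrow> 0"
    proof -
      have "(\<lambda>n. K * t * (sqrt (t / real n) + t / real n)) \<longlonglongrightarrow> K * t * (sqrt 0 + 0)"
        by (intro tendsto_intros tendsto_divide_0 filterlim_real_at_infinity_sequentially)
      then show ?thesis by simp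
    qed
    ultimately have "(\<lambda>n. (\<integral>\<omega>. D (S n \<omega>) \<omega> \<partial>M) - V) \<longlonglongrightarrow> 0"
      by (rule Lim_null_comparison)
    then show ?thesis
      by (simp add: LIM_zero_iff)
  qed
  ultimately show ?thesis
    unfolding V_def D_def I_def by (rule LIMSEQ_unique)
qed

end

section \<open>The Laplace transform\<close>

text \<open>For \<open>y < 1\<close> the value of \<^const>\<open>arcosh\<close> is imaginary. In both cases the principal square root
of \<open>y\<^sup>2 - 1\<close> has nonnegative real part, so \<open>e\<^sup>x = y + sqrt (y\<^sup>2 - 1)\<close> lies in the right half
plane, which is the meaning of \<^term>\<open>0 < cos (Im x)\<close>.\<close>

lemma arcosh_of_real_pos:
  assumes "0 < y"
  shows "cosh (arcosh (complex_of_real y)) = of_real y"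
    and "0 < cos (Im (arcosh (complex_of_real y)))"
proof -
  define z s where "z = (complex_of_real y)\<^sup>2 - 1" and "s = z powr of_real (1 / 2)"
  have s: "s\<^sup>2 = z" "0 \<le> Re s"
  proof -
    have "s = csqrt z"
      by (cases "z = 0") (auto simp: s_def powr_def csqrt_exp_Ln)
    then show "s\<^sup>2 = z" "0 \<le> Re s"
      using csqrt_principal[of z] by auto
  qed
  have "(of_real y + s) * (of_real y - s) = 1"
    using s by (simp add: z_def power2_eq_square algebra_simps)
  moreover from this have "exp (arcosh (complex_of_real y)) = of_real y + s"
    by (subst arcosh_def, fold z_def s_def) (auto intro!: exp_Ln)
  ultimately have e: "exp (arcosh (complex_of_real y)) = of_real y + s" "exp (- arcosh (complex_of_real y)) = of_real y - s"
    by (auto simp: exp_minus inverse_eq_divide divide_eq_eq mult.commute)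
  show "cosh (arcosh (complex_of_real y)) = of_real y"
    by (simp add: cosh_field_def e)
  have "0 < Re (exp (arcosh (complex_of_real y)))"
    using s assms by (simp add: e)
  then show "0 < cos (Im (arcosh (complex_of_real y)))"
    by (simp add: Re_exp zero_less_mult_iff)
qed

theorem proposition2p4:
  fixes M :: "'a measure" and B :: "real \<Rightarrow> 'a \<Rightarrow> real"
    and t \<gamma> lam :: real and x :: complex
  assumes "standard_brownian_motion M B"
    and "0 \<le> t" and "\<gamma> > 0" and "lam > 0"
    and "x = arcosh (complex_of_real (\<gamma> / lam))"
  shows "complex_of_real
           (LINT \<omega>|M. exp (- \<gamma> * exp (B t \<omega>)
              - lam\<^sup>2 / 2 * (LBINT u:{0..t}. exp (2 * B u \<omega>))))
         = (LINT \<omega>|M. exp (- complex_of_real lam * cosh (x + complex_of_real (B t \<omega>))))"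
proof -
  interpret standard_brownian_motion M B by fact
  have x: "cosh x = of_real (\<gamma> / lam)" "0 < cos (Im x)"
    using assms arcosh_of_real_pos[of "\<gamma> / lam"] by auto
  have "complex_of_real (exp (- \<gamma> * exp (B t \<omega>) - lam\<^sup>2 / 2 * (LBINT u:{0..t}. exp (2 * B u \<omega>))))
      = of_real (exp (- (lam\<^sup>2 / 2 * (LBINT u:{0..t}. exp (2 * B u \<omega>))))) * cosh_kernel (lam * exp (B t \<omega>)) x" for \<omega>
  proof -
    have "cosh_kernel (lam * exp (B t \<omega>)) x = of_real (exp (- \<gamma> * exp (B t \<omega>)))"
      using \<open>lam > 0\<close> by (simp add: cosh_kernel_def x exp_of_real[symmetric] mult.commute)
    moreover have "exp (- \<gamma> * exp (B t \<omega>) - lam\<^sup>2 / 2 * (LBINT u:{0..t}. exp (2 * B u \<omega>)))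
        = exp (- (lam\<^sup>2 / 2 * (LBINT u:{0..t}. exp (2 * B u \<omega>)))) * exp (- \<gamma> * exp (B t \<omega>))"
      by (simp flip: exp_add)
    ultimately show ?thesis
      by (simp only: of_real_mult)
  qed
  then have "complex_of_real (LINT \<omega>|M. exp (- \<gamma> * exp (B t \<omega>) - lam\<^sup>2 / 2 * (LBINT u:{0..t}. exp (2 * B u \<omega>))))
      = (LINT \<omega>|M. cosh_kernel lam (x + of_real (B t \<omega>)))"
    using laplace_transform_exp_functional[OF \<open>0 \<le> t\<close> \<open>lam > 0\<close> x(2)]
    by (simp flip: integral_complex_of_real)
  then show ?thesis
    by (simp only: cosh_kernel_def)
qed

end
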